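(* Let $(W,S)$ be an FC-finite Coxeter group (with $S$ finite), and let $E=[E,\leq,\varepsilon]$ be the heap of a fully commutative element of $W$. The following are equivalent: (i) $E$ is ranked; (ii) for each minimal balanced subinterval $[a,b]$ of $E$, either (a) all the elements of $S_{[a,b]}$ have the same label, or (b) all the elements of $S_{[a,b]}$ have distinct labels.
   Context: A Coxeter group $(W,S)$ is the group generated by a finite set $S$ subject to $(st)^{m(s,t)}=1$, where $m(s,s)=1$ and $2\leq m(s,t)=m(t,s)\leq\infty$ for $s\neq t$. Define a relation $\mathcal{C}$ on $S$ by $s\,\mathcal{C}\,t$ iff $m(s,t)\neq 2$. A labelled heap with pieces in $S$ is a triple $(E,\leq,\varepsilon)$ with $(E,\leq)$ a finite poset and $\varepsilon:E\to S$ such that: (1) if $\varepsilon(\alpha)\,\mathcal{C}\,\varepsilon(\beta)$ then $\alpha,\beta$ are comparable; (2) $\leq$ is the transitive closure of the relation: $\alpha\leq\beta$ and $\varepsilon(\alpha)\,\mathcal{C}\,\varepsilon(\beta)$. A heap is a labelled heap up to label-preserving poset isomorphism; $\varepsilon(x)$ is the label of $x$. A chain $\beta_1<\cdots<\beta_r$ is convex if every $\gamma$ with $\beta_i<\gamma<\beta_j$ lies in the chain. A heap $E$ is the heap of a fully commutative element of $W$ iff: (1) there is no convex chain $\alpha_1<\cdots<\alpha_m$ with $\varepsilon(\alpha_i)=s$ for odd $i$ and $\varepsilon(\alpha_i)=t$ for even $i$, where $3\leq m=m(s,t)<\infty$; (2) there is no covering relation $\alpha<\beta$ with $\varepsilon(\alpha)=\varepsilon(\beta)$.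 $(W,S)$ is FC-finite if there are only finitely many such heaps (equivalently, finitely many fully commutative elements). A covering relation $a<b$ means no $c$ with $a<c<b$; a rank function is $\rho:E\to\mathbb{Z}$ with $\rho(b)=\rho(a)+1$ for every covering relation $a<b$; $E$ is ranked if one exists. For $a\leq b$, $[a,b]=\{x:a\leq x\leq b\}$; it is a minimal balanced subinterval if $a\neq b$, $\varepsilon(a)=\varepsilon(b)$, and no $c\in[a,b]$ other than $a,b$ has label $\varepsilon(a)$. For such $[a,b]$, $S_{[a,b]}=\{c\in[a,b]:\varepsilon(c)\neq\varepsilon(a)\text{ and }\varepsilon(a)\,\mathcal{C}\,\varepsilon(c)\}$. *)

theory Defs
  imports Main "HOL-Library.Extended_Nat" "HOL-Library.FuncSet"
begin

section \<open>Coxeter systems\<close>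

text \<open>A Coxeter system is given by its generating set \<open>S\<close> and its Coxeter matrix \<open>m\<close>; the group
  itself is determined by these through the presentation \<open>(s t)^m(s,t) = 1\<close>. The value \<open>\<infinity>\<close> means
  that no relation is imposed on \<open>s t\<close>. Values of \<open>m\<close> outside \<open>S\<close> are irrelevant.\<close>

definition coxeter_matrix :: "'s set \<Rightarrow> ('s \<Rightarrow> 's \<Rightarrow> enat) \<Rightarrow> bool" where
  "coxeter_matrix S m \<longleftrightarrow>
     finite S \<and> (\<forall>s\<in>S. m s s = 1) \<and>
     (\<forall>s\<in>S. \<forall>t\<in>S. s \<noteq> t \<longrightarrow> 2 \<le> m s t \<and> m s t = m t s)"

definition concur :: "('s \<Rightarrow> 's \<Rightarrow> enat) \<Rightarrow> 's \<Rightarrow> 's \<Rightarrow> bool" where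
  "concur m s t \<longleftrightarrow> m s t \<noteq> 2"

section \<open>Labelled heaps\<close>

text \<open>A labelled heap \<open>(E, le, lab)\<close> consists of a finite carrier, the graph \<open>le\<close> of a partial order
  on it (so \<open>le \<subseteq> E \<times> E\<close>), and a labelling, whose values outside \<open>E\<close> are irrelevant.\<close>

definition labelled_heap ::
  "'s set \<Rightarrow> ('s \<Rightarrow> 's \<Rightarrow> enat) \<Rightarrow> 'a set \<Rightarrow> 'a rel \<Rightarrow> ('a \<Rightarrow> 's) \<Rightarrow> bool" where
  "labelled_heap S m E le lab \<longleftrightarrow>
     finite E \<and> partial_order_on E le \<and> lab \<in> E \<rightarrow> S \<and>
     (\<forall>x\<in>E. \<forall>y\<in>E. concur m (lab x) (lab y) \<longrightarrow> (x, y) \<in> le \<or> (y, x) \<in> le) \<and>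
     le = {(x, y). (x, y) \<in> le \<and> concur m (lab x) (lab y)}\<^sup>+"

definition less_in :: "'a rel \<Rightarrow> 'a \<Rightarrow> 'a \<Rightarrow> bool" where
  "less_in le x y \<longleftrightarrow> (x, y) \<in> le \<and> x \<noteq> y"

definition covers :: "'a rel \<Rightarrow> 'a \<Rightarrow> 'a \<Rightarrow> bool" where
  "covers le x y \<longleftrightarrow> less_in le x y \<and> (\<nexists>z. less_in le x z \<and> less_in le z y)"

definition convex_chain :: "'a set \<Rightarrow> 'a rel \<Rightarrow> 'a list \<Rightarrow> bool" where
  "convex_chain E le xs \<longleftrightarrow>
     set xs \<subseteq> E \<and> sorted_wrt (less_in le) xs \<and>
     (\<forall>x\<in>set xs. \<forall>y\<in>set xs. \<forall>z. less_in le x z \<and> less_in le z y \<longrightarrow> z \<in> set xs)"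

text \<open>List positions are counted from \<open>0\<close>, so the even positions below are the members
  \<open>\<alpha>\<^sub>1, \<alpha>\<^sub>3, \<dots>\<close> of a chain \<open>\<alpha>\<^sub>1 < \<alpha>\<^sub>2 < \<dots>\<close> numbered from \<open>1\<close>.\<close>

definition fc_heap ::
  "'s set \<Rightarrow> ('s \<Rightarrow> 's \<Rightarrow> enat) \<Rightarrow> 'a set \<Rightarrow> 'a rel \<Rightarrow> ('a \<Rightarrow> 's) \<Rightarrow> bool" where
  "fc_heap S m E le lab \<longleftrightarrow>
     labelled_heap S m E le lab \<and>
     \<not> (\<exists>s\<in>S. \<exists>t\<in>S. \<exists>xs. convex_chain E le xs \<and>
          3 \<le> length xs \<and> enat (length xs) = m s t \<and>
          (\<forall>i<length xs. lab (xs ! i) = (if even i then s else t))) \<and>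
     \<not> (\<exists>x y. covers le x y \<and> lab x = lab y)"

section \<open>Heaps up to isomorphism and FC-finiteness\<close>

fun heap_iso :: "'a set \<times> 'a rel \<times> ('a \<Rightarrow> 's) \<Rightarrow> 'b set \<times> 'b rel \<times> ('b \<Rightarrow> 's) \<Rightarrow> bool" where
  "heap_iso (E, le, lab) (E', le', lab') \<longleftrightarrow>
     (\<exists>f. bij_betw f E E' \<and>
          (\<forall>x\<in>E. \<forall>y\<in>E. (x, y) \<in> le \<longleftrightarrow> (f x, f y) \<in> le') \<and>
          (\<forall>x\<in>E. lab' (f x) = lab x))"

text \<open>Every finite labelled poset is isomorphic to one whose carrier is a set of natural numbers, so
  the isomorphism classes of all heaps of fully commutative elements are represented by the classes
  of such heaps with carrier in \<^typ>\<open>nat\<close>.\<close>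

definition fc_nat_heaps ::
  "'s set \<Rightarrow> ('s \<Rightarrow> 's \<Rightarrow> enat) \<Rightarrow> (nat set \<times> nat rel \<times> (nat \<Rightarrow> 's)) set" where
  "fc_nat_heaps S m = {(E, le, lab). fc_heap S m E le lab}"

definition fc_finite :: "'s set \<Rightarrow> ('s \<Rightarrow> 's \<Rightarrow> enat) \<Rightarrow> bool" where
  "fc_finite S m \<longleftrightarrow>
     finite (fc_nat_heaps S m //
       {(H, K). H \<in> fc_nat_heaps S m \<and> K \<in> fc_nat_heaps S m \<and> heap_iso H K})"

section \<open>Rank functions and balanced subintervals\<close>

definition ranked :: "'a rel \<Rightarrow> bool" where
  "ranked le \<longleftrightarrow> (\<exists>\<rho> :: 'a \<Rightarrow> int. \<forall>x y. covers le x y \<longrightarrow> \<rho> y = \<rho> x + 1)"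

definition interval :: "'a rel \<Rightarrow> 'a \<Rightarrow> 'a \<Rightarrow> 'a set" where
  "interval le a b = {x. (a, x) \<in> le \<and> (x, b) \<in> le}"

definition minimal_balanced :: "'a rel \<Rightarrow> ('a \<Rightarrow> 's) \<Rightarrow> 'a \<Rightarrow> 'a \<Rightarrow> bool" where
  "minimal_balanced le lab a b \<longleftrightarrow>
     (a, b) \<in> le \<and> a \<noteq> b \<and> lab a = lab b \<and>
     (\<forall>c\<in>interval le a b. lab c = lab a \<longrightarrow> c = a \<or> c = b)"

definition adjacent_pieces ::
  "('s \<Rightarrow> 's \<Rightarrow> enat) \<Rightarrow> 'a rel \<Rightarrow> ('a \<Rightarrow> 's) \<Rightarrow> 'a \<Rightarrow> 'a \<Rightarrow> 'a set" where
  "adjacent_pieces m le lab a b =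
     {c \<in> interval le a b. lab c \<noteq> lab a \<and> concur m (lab a) (lab c)}"

end

theory Submission
  imports Defs
begin

text \<open>FC-finiteness is used through one construction. An infinite word yields FC heaps of every size
  once any two occurrences of a letter enclose two adjacent letters, or one that is joined to it by
  an edge labelled at least \<open>4\<close> and whose own occurrences always enclose two adjacent letters.
  Non-backtracking infinite walks in the Coxeter graph are such
  words, so the graph is a forest; and so are zigzags along a path whose two ends are forks or
  edges labelled at least \<open>4\<close>.

  Suppose that \<open>E\<close> is ranked and that (a) and (b) fail for \<open>[a, b]\<close>. A label occurring only once in
  \<open>S\<^bsub>[a,b]\<^esub>\<close> would force \<open>\<rho>(b) = \<rho>(a) + 2\<close>, and a repeated one forces a larger difference, so at least
  two labels occur, each of them twice. Descending into the interval between two such occurrences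
  leads, on each of the two branches, to a reflecting end, and a zigzag between these ends
  contradicts FC-finiteness.

  Conversely, a rank function is built by adding maximal elements \<open>x\<close> one at a time. If an earlier
  element has the label of \<open>x\<close>, let \<open>a\<close> be the last one: (a) or (b) for \<open>[a, x]\<close> shows that all
  elements covered by \<open>x\<close> already have the same rank. Otherwise these elements lie on different
  branches of the forest at the label of \<open>x\<close>, and the rank can be shifted on each branch.\<close>

section \<open>Words with infinitely many fully commutative prefixes\<close>

text \<open>Unbounded size stands for infinitely many classes, since heaps of different sizes are
  never isomorphic.\<close>

definition infinitely_many_fc :: "'s set \<Rightarrow> ('s \<Rightarrow> 's \<Rightarrow> enat) \<Rightarrow> bool" where
  "infinitely_many_fc S m \<longleftrightarrow>
     (\<forall>n. \<exists>(E :: nat set) le lab. fc_heap S m E le lab \<and> n \<le> card E)"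

lemma heap_iso_refl: "heap_iso H H"
proof (cases H)
  case (fields E le lab)
  then show ?thesis by (auto intro!: exI[of _ id])
qed

lemma heap_iso_card: "heap_iso H K \<Longrightarrow> card (fst H) = card (fst K)"
  by (cases H; cases K) (auto dest: bij_betw_same_card)

text \<open>Every heap lies in its own class and has the size of the chosen member of it, so
  finitely many classes allow only finitely many sizes.\<close>

lemma fc_finite_not_infinitely_many:
  assumes "fc_finite S m"
  shows "\<not> infinitely_many_fc S m"
proof
  assume inf: "infinitely_many_fc S m"
  define X where "X = fc_nat_heaps S m"
  define R where "R = {(H, K). H \<in> X \<and> K \<in> X \<and> heap_iso H K}"
  have fin: "finite (X // R)"
    using assms by (simp add: fc_finite_def X_def R_def)
  have "card (fst H) \<in> (\<lambda>C. card (fst (SOME K. K \<in> C))) ` (X // R)" if "H \<in> X" for H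
  proof (rule image_eqI)
    show "R `` {H} \<in> X // R" using that by (rule quotientI)
    have "H \<in> R `` {H}" using that by (simp add: R_def heap_iso_refl)
    then have "(SOME K. K \<in> R `` {H}) \<in> R `` {H}" by (rule someI)
    then show "card (fst H) = card (fst (SOME K. K \<in> R `` {H}))"
      by (auto simp: R_def dest: heap_iso_card)
  qed
  then have "(\<lambda>H. card (fst H)) ` X \<subseteq> (\<lambda>C. card (fst (SOME K. K \<in> C))) ` (X // R)"
    by blast
  then have "finite ((\<lambda>H. card (fst H)) ` X)"
    using fin by (meson finite_imageI finite_subset)
  then obtain b where b: "\<And>H. H \<in> X \<Longrightarrow> card (fst H) \<le> b"
    by (meson finite_nat_set_iff_bounded_le imageI)
  obtain E :: "nat set" and le lab where "fc_heap S m E le lab" "Suc b \<le> card E"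
    using inf by (meson infinitely_many_fc_def)
  then show False
    using b[of "(E, le, lab)"] by (simp add: X_def fc_nat_heaps_def)
qed

section \<open>The Coxeter graph and heaps of words\<close>

locale coxeter_graph =
  fixes S :: "'s set" and m :: "'s \<Rightarrow> 's \<Rightarrow> enat"
  assumes coxeter: "coxeter_matrix S m"
begin

text \<open>The edge relation of the Coxeter graph. Membership in \<open>S\<close> is built in
  because the values of \<open>m\<close> outside \<open>S\<close> are arbitrary.\<close>

definition adj :: "'s \<Rightarrow> 's \<Rightarrow> bool" where
  "adj s t \<longleftrightarrow> s \<in> S \<and> t \<in> S \<and> s \<noteq> t \<and> concur m s t"

lemma concur_sym: "s \<in> S \<Longrightarrow> t \<in> S \<Longrightarrow> concur m s t \<Longrightarrow> concur m t s"
  using coxeter by (metis concur_def coxeter_matrix_def)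

lemma adj_sym: "adj s t \<Longrightarrow> adj t s"
  by (auto simp: adj_def dest: concur_sym)

lemma adj_irrefl: "\<not> adj s s"
  by (simp add: adj_def)

lemma concur_refl: "s \<in> S \<Longrightarrow> concur m s s"
  using coxeter by (auto simp: concur_def coxeter_matrix_def one_enat_def numeral_eq_enat)

definition two_between :: "nat set \<Rightarrow> (nat \<Rightarrow> 's) \<Rightarrow> nat \<Rightarrow> nat \<Rightarrow> bool" where
  "two_between A f i j \<longleftrightarrow> (\<exists>k\<in>A. \<exists>l\<in>A. i < k \<and> k < l \<and> l < j \<and> adj (f i) (f k) \<and> adj (f i) (f l))"

text \<open>An infinite word, written on an arbitrary infinite set of positions. A convex alternating
  chain \<open>s t s \<dots>\<close> has a single piece between its first two \<open>s\<close>, which is excluded by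
  \<open>two_between\<close>; in the other case a chain \<open>s t s t \<dots>\<close> of length at least \<open>4\<close> is
  excluded by looking at its first two \<open>t\<close>.\<close>

lemma infinite_word:
  assumes A: "infinite A" and fS: "\<And>i. i \<in> A \<Longrightarrow> f i \<in> S"
    and cond: "\<And>i j. i \<in> A \<Longrightarrow> j \<in> A \<Longrightarrow> i < j \<Longrightarrow> f i = f j \<Longrightarrow> two_between A f i j \<or>
      (\<exists>k\<in>A. i < k \<and> k < j \<and> adj (f i) (f k) \<and> 4 \<le> m (f i) (f k) \<and>
        (\<forall>i'\<in>A. \<forall>j'\<in>A. i' < j' \<and> f i' = f k \<and> f j' = f k \<longrightarrow> two_between A f i' j'))"
  shows "infinitely_many_fc S m"
  unfolding infinitely_many_fc_def
proof
  fix n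
  obtain B where B: "finite B" "card B = n" "B \<subseteq> A"
    using A by (metis infinite_arbitrarily_large)
  obtain N where N: "\<And>k. k \<in> B \<Longrightarrow> k < N"
    using B(1) by (meson finite_nat_set_iff_bounded)
  \<comment> \<open>The heap of the finite word on the positions below \<open>N\<close>: its order
    is generated by the pairs of positions, in word order, whose letters satisfy
    \<open>concur\<close>.\<close>
  define E where "E = {k\<in>A. k < N}"
  define r where "r = {(i, j). i \<in> E \<and> j \<in> E \<and> i \<le> j \<and> concur m (f i) (f j)}"
  define le where "le = r\<^sup>+"
  have "B \<subseteq> E" using B N by (auto simp: E_def)
  moreover have finE: "finite E" by (simp add: E_def)
  ultimately have card: "n \<le> card E" using B(2) card_mono by blast
  have le_sub: "i \<in> E \<and> j \<in> E \<and> i \<le> j" if "(i, j) \<in> le" for i j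
    using that unfolding le_def by (induction rule: trancl.induct) (auto simp: r_def)
  have r_le: "(i, j) \<in> le" if "i \<in> E" "j \<in> E" "i \<le> j" "concur m (f i) (f j)" for i j
    using that by (auto simp: le_def r_def)
  have concur_f: "concur m (f i) (f i)" if "i \<in> E" for i
    using that fS by (auto simp: E_def intro: concur_refl)
  have po: "partial_order_on E le"
  proof -
    have "le \<subseteq> E \<times> E" "antisym le"
      using le_sub by (auto simp: antisym_def intro: order.antisym)
    moreover have "refl_on E le"
      using r_le concur_f by (simp add: refl_on_def)
    ultimately show ?thesis
      by (simp add: partial_order_on_def preorder_on_def le_def)
  qed
  have "le = {(x, y). (x, y) \<in> le \<and> concur m (f x) (f y)}\<^sup>+"
  proof
    have "r \<subseteq> {(x, y). (x, y) \<in> le \<and> concur m (f x) (f y)}"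
      by (auto simp: r_def le_def)
    then show "le \<subseteq> {(x, y). (x, y) \<in> le \<and> concur m (f x) (f y)}\<^sup>+"
      unfolding le_def by (rule trancl_mono_subset)
    have "{(x, y). (x, y) \<in> le \<and> concur m (f x) (f y)}\<^sup>+ \<subseteq> le\<^sup>+"
      by (rule trancl_mono_subset) auto
    also have "le\<^sup>+ = le" by (simp add: le_def)
    finally show "{(x, y). (x, y) \<in> le \<and> concur m (f x) (f y)}\<^sup>+ \<subseteq> le" .
  qed
  moreover have "concur m (f x) (f y) \<longrightarrow> (x, y) \<in> le \<or> (y, x) \<in> le" if "x \<in> E" "y \<in> E" for x y
  proof
    assume c: "concur m (f x) (f y)"
    then have "concur m (f y) (f x)" using that fS concur_sym by (simp add: E_def)
    then show "(x, y) \<in> le \<or> (y, x) \<in> le" using c r_le that by (meson nat_le_linear)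
  qed
  ultimately have heap: "labelled_heap S m E le f"
    unfolding labelled_heap_def using po finE fS by (simp add: E_def)
  have lessI: "less_in le i j" if "i \<in> E" "j \<in> E" "i < j" "adj (f i) (f j)" for i j
    using that r_le[of i j] by (auto simp: less_in_def adj_def)
  have between: "less_in le i k \<and> less_in le k j"
    if "i \<in> E" "j \<in> E" "k \<in> A" "i < k" "k < j" "adj (f i) (f k)" "f i = f j" for i j k
  proof -
    have "k \<in> E" using that by (auto simp: E_def)
    then show ?thesis using that lessI adj_sym by metis
  qed
  have lt: "i < j \<and> i \<in> A \<and> j \<in> A \<and> i \<in> E \<and> j \<in> E" if "less_in le i j" for i j
    using that le_sub[of i j] by (auto simp: less_in_def E_def)
  have no_cover: "\<not> (covers le x y \<and> f x = f y)" for x y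
  proof
    assume c: "covers le x y \<and> f x = f y"
    then have l: "less_in le x y" by (simp add: covers_def)
    have "two_between A f x y \<or> (\<exists>k\<in>A. x < k \<and> k < y \<and> adj (f x) (f k))"
      using cond[of x y] lt[OF l] c by blast
    then obtain k where "k \<in> A" "x < k" "k < y" "adj (f x) (f k)"
      unfolding two_between_def by (meson order.strict_trans)
    then show False using between[of x y k] lt[OF l] c by (auto simp: covers_def)
  qed
  \<comment> \<open>Convexity leaves a single element strictly between chain members two places
    apart, so two witnesses \<open>k < l\<close> cannot exist.\<close>
  have no_two: False
    if ch: "convex_chain E le xs" and i: "Suc (Suc i) < length xs"
      and eq: "f (xs ! Suc (Suc i)) = f (xs ! i)"
      and two: "two_between A f (xs ! i) (xs ! Suc (Suc i))" for xs i
  proof -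
    let ?a = "xs ! i" and ?b = "xs ! Suc (Suc i)"
    have srt: "sorted_wrt (less_in le) xs" using ch by (simp add: convex_chain_def)
    have ab: "less_in le ?a ?b" using srt i by (simp add: sorted_wrt_nth_less)
    have mid: "z = xs ! Suc i" if "less_in le ?a z" "less_in le z ?b" for z
    proof -
      have "?a \<in> set xs" "?b \<in> set xs" using i by simp_all
      then have "z \<in> set xs" using ch that unfolding convex_chain_def by blast
      then obtain p where p: "p < length xs" "z = xs ! p" by (metis in_set_conv_nth)
      have inc: "xs ! p1 < xs ! p2" if "p1 < p2" "p2 < length xs" for p1 p2
        using srt that lt by (simp add: sorted_wrt_nth_less)
      have "?a < z" "z < ?b" using that lt by auto
      then have "i < p" "p < Suc (Suc i)"
        using p inc[of p i] inc[of "Suc (Suc i)" p] i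
        by (metis Suc_lessD linorder_neqE_nat order_less_asym)+
      then have "p = Suc i" by linarith
      then show ?thesis using p by simp
    qed
    obtain k l where kl: "k \<in> A" "l \<in> A" "?a < k" "k < l" "l < ?b"
        "adj (f ?a) (f k)" "adj (f ?a) (f l)"
      using two by (auto simp: two_between_def)
    have ends: "?a \<in> E" "?b \<in> E" using lt[OF ab] by simp_all
    have "k = xs ! Suc i"
      using mid between[OF ends kl(1,3) less_trans[OF kl(4,5)] kl(6) eq[symmetric]] by blast
    moreover have "l = xs ! Suc i"
      using mid between[OF ends kl(2) less_trans[OF kl(3,4)] kl(5,7) eq[symmetric]] by blast
    ultimately show False using kl by simp
  qed
  have no_chain: "\<not> (\<exists>s\<in>S. \<exists>t\<in>S. \<exists>xs. convex_chain E le xs \<and>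
          3 \<le> length xs \<and> enat (length xs) = m s t \<and>
          (\<forall>i<length xs. f (xs ! i) = (if even i then s else t)))"
  proof clarify
    fix s t xs
    assume ch: "convex_chain E le xs" and len: "3 \<le> length xs" and mst: "enat (length xs) = m s t"
      and alt: "\<forall>i<length xs. f (xs ! i) = (if even i then s else t)"
    have pos: "0 < length xs" "Suc 0 < length xs" "Suc (Suc 0) < length xs" using len by linarith+
    have f0: "f (xs ! 0) = s" using alt[rule_format, of 0] pos by simp
    have f1: "f (xs ! Suc 0) = t" using alt[rule_format, of "Suc 0"] pos by simp
    have f2: "f (xs ! Suc (Suc 0)) = s" using alt[rule_format, of "Suc (Suc 0)"] pos by simp
    have srt: "sorted_wrt (less_in le) xs" using ch by (simp add: convex_chain_def)
    have l02: "less_in le (xs ! 0) (xs ! Suc (Suc 0))"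
      using srt pos by (simp add: sorted_wrt_nth_less)
    have "\<not> two_between A f (xs ! 0) (xs ! Suc (Suc 0))"
      using no_two[of xs 0] ch pos f0 f2 by auto
    then obtain k where k: "k \<in> A" "xs ! 0 < k" "k < xs ! Suc (Suc 0)" "adj s (f k)" "4 \<le> m s (f k)"
      and ktwo: "\<forall>i'\<in>A. \<forall>j'\<in>A. i' < j' \<and> f i' = f k \<and> f j' = f k \<longrightarrow> two_between A f i' j'"
      using cond[of "xs ! 0" "xs ! Suc (Suc 0)"] lt[OF l02] f0 f2 by auto
    have "less_in le (xs ! 0) k \<and> less_in le k (xs ! Suc (Suc 0))"
      using between[of "xs ! 0" "xs ! Suc (Suc 0)" k] lt[OF l02] f0 f2 k by simp
    moreover have "xs ! 0 \<in> set xs" "xs ! Suc (Suc 0) \<in> set xs" using pos by (simp_all only: nth_mem)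
    ultimately have "k \<in> set xs" using ch unfolding convex_chain_def by blast
    then have "f k \<in> {s, t}" using alt by (auto simp: in_set_conv_nth)
    then have fk: "f k = t" using k(4) adj_irrefl by auto
    \<comment> \<open>The neighbour \<open>k\<close> lies on the chain and carries \<open>t\<close>.
      Hence \<open>m s t\<close> is at least 4, so the chain has a second \<open>t\<close>, and
      \<open>ktwo\<close> applies to its first two.\<close>
    then have len4: "4 \<le> length xs"
      using k(5) mst by (metis enat_ord_simps(1) numeral_eq_enat)
    then have f3: "f (xs ! Suc (Suc (Suc 0))) = t" using alt[rule_format, of "Suc (Suc (Suc 0))"] by simp
    have l13: "less_in le (xs ! Suc 0) (xs ! Suc (Suc (Suc 0)))"
      using srt len4 by (simp add: sorted_wrt_nth_less)
    have "two_between A f (xs ! Suc 0) (xs ! Suc (Suc (Suc 0)))"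
      using ktwo lt[OF l13] f1 f3 fk by auto
    then show False using no_two[of xs "Suc 0"] ch len4 f1 f3 by auto
  qed
  have "fc_heap S m E le f"
    unfolding fc_heap_def using heap no_chain no_cover by blast
  then show "\<exists>(E :: nat set) le lab. fc_heap S m E le lab \<and> n \<le> card E"
    using card by blast
qed

section \<open>Words written in layers\<close>

definition nontriv :: "'s set \<Rightarrow> bool" where
  "nontriv X \<longleftrightarrow> (\<exists>x\<in>X. \<exists>y\<in>X. x \<noteq> y)"

text \<open>Equal letters at different positions lie at least two layers apart, since letters of
  consecutive layers are adjacent. If they are further apart, the layer after the first and the
  layer before the second supply two neighbours; only distance two needs
  \<open>turn\<close>.\<close>

lemma infinite_layers:
  fixes F :: "nat \<Rightarrow> 's set"
  assumes shape: "\<And>i. \<exists>x y. F i = {x, y}"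
    and adjF: "\<And>i x y. x \<in> F i \<Longrightarrow> y \<in> F (Suc i) \<Longrightarrow> adj x y"
    and turn: "\<And>i x. x \<in> F i \<Longrightarrow> x \<in> F (Suc (Suc i)) \<Longrightarrow> nontriv (F (Suc i)) \<or>
      (\<exists>y\<in>F (Suc i). 4 \<le> m x y \<and>
         (\<forall>j. y \<in> F j \<and> y \<in> F (Suc (Suc j)) \<longrightarrow> nontriv (F (Suc j))))"
  shows "infinitely_many_fc S m"
proof -
  obtain g g' where F: "\<And>i. F i = {g i, g' i}" using shape by metis
  \<comment> \<open>The layer \<open>{g i, g' i}\<close> sits at the positions \<open>2 * i\<close> and, if it has two elements, \<open>2 * i + 1\<close>.\<close>
  define A where "A = {k. even k \<or> g' (k div 2) \<noteq> g (k div 2)}"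
  define f where "f k = (if even k then g (k div 2) else g' (k div 2))" for k :: nat
  have posn: "\<exists>k\<in>A. k div 2 = i \<and> f k = x" if x: "x \<in> F i" for x i
  proof (cases "x = g i")
    case True
    then show ?thesis by (intro bexI[of _ "2 * i"]) (auto simp: A_def f_def)
  next
    case False
    then show ?thesis using x by (intro bexI[of _ "2 * i + 1"]) (auto simp: A_def f_def F)
  qed
  have fF: "f k \<in> F (k div 2)" for k by (simp add: f_def F)
  have inj: "k = l" if "k \<in> A" "l \<in> A" "k div 2 = l div 2" "f k = f l" for k l
  proof (cases "even k = even l")
    case True
    then show ?thesis using that(3) by (metis even_two_times_div_two odd_two_times_div_two_succ)
  next
    case False
    then show ?thesis using that by (auto simp: A_def f_def split: if_splits)
  qed
  have two: "two_between A f k l"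
    if y: "y \<in> F p" "adj (f k) y" and z: "z \<in> F q" "adj (f k) z"
      and ord: "k div 2 < p" "p < l div 2" "k div 2 < q" "q < l div 2" and ne: "p \<noteq> q \<or> y \<noteq> z"
    for k l y z p q
  proof -
    obtain c d where cd: "c \<in> A" "c div 2 = p" "f c = y" "d \<in> A" "d div 2 = q" "f d = z"
      using posn y z by metis
    then have "c \<noteq> d" using ne by blast
    moreover have "k < c" "c < l" "k < d" "d < l"
      using ord cd(2,5) by (auto intro: ccontr simp: not_less dest: div_le_mono[of _ _ 2])
    ultimately show ?thesis
      unfolding two_between_def using y z cd by (metis linorder_neqE_nat)
  qed
  have gap: "Suc (Suc (k div 2)) = l div 2 \<or> Suc (Suc (k div 2)) < l div 2"
    if "k \<in> A" "l \<in> A" "k < l" "f k = f l" for k l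
  proof -
    have "k div 2 \<le> l div 2" using that(3) by (simp add: div_le_mono)
    moreover have "k div 2 \<noteq> l div 2" using inj that by blast
    moreover have "Suc (k div 2) \<noteq> l div 2" using adjF fF that(4) adj_irrefl by metis
    ultimately show ?thesis by linarith
  qed
  have ne: "\<exists>x. x \<in> F i" for i using F by blast
  have far: "two_between A f k l"
    if "k \<in> A" "l \<in> A" "k < l" "f k = f l"
      and c: "Suc (Suc (k div 2)) = l div 2 \<Longrightarrow> nontriv (F (Suc (k div 2)))" for k l
    using gap[OF that(1-4)]
  proof
    assume e: "Suc (Suc (k div 2)) = l div 2"
    then obtain y z where "y \<in> F (Suc (k div 2))" "z \<in> F (Suc (k div 2))" "y \<noteq> z"
      using c by (auto simp: nontriv_def)
    then show ?thesis using two[of y "Suc (k div 2)" k z "Suc (k div 2)" l] adjF fF e by auto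
  next
    assume lt: "Suc (Suc (k div 2)) < l div 2"
    obtain y where y: "y \<in> F (Suc (k div 2))" using ne by blast
    obtain z where z: "z \<in> F (l div 2 - 1)" using ne by blast
    have "l div 2 = Suc (l div 2 - 1)" using lt by simp
    then have "adj z (f l)" using adjF[OF z] fF[of l] by simp
    then have "adj (f k) z" using that(4) adj_sym by simp
    moreover have "adj (f k) y" using adjF fF y by blast
    moreover have "k div 2 < Suc (k div 2)" "Suc (k div 2) < l div 2"
      "k div 2 < l div 2 - 1" "l div 2 - 1 < l div 2" "Suc (k div 2) \<noteq> l div 2 - 1"
      using lt by linarith+
    ultimately show ?thesis using two[OF y _ z] by blast
  qed
  have fS: "f i \<in> S" for i using ne[of "Suc (i div 2)"] adjF fF[of i] by (auto simp: adj_def)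
  show ?thesis
  proof (rule infinite_word[of A f])
    have "(\<lambda>i. 2 * i) ` (UNIV :: nat set) \<subseteq> A" by (auto simp: A_def)
    moreover have "infinite ((\<lambda>i. 2 * i) ` (UNIV :: nat set))"
      by (rule range_inj_infinite) (simp add: inj_on_def)
    ultimately show "infinite A" by (rule infinite_super)
    show "f i \<in> S" for i by (rule fS)
    fix i j assume ij: "i \<in> A" "j \<in> A" "i < j" "f i = f j"
    show "two_between A f i j \<or>
      (\<exists>k\<in>A. i < k \<and> k < j \<and> adj (f i) (f k) \<and> 4 \<le> m (f i) (f k) \<and>
        (\<forall>i'\<in>A. \<forall>j'\<in>A. i' < j' \<and> f i' = f k \<and> f j' = f k \<longrightarrow> two_between A f i' j'))"
    proof (cases "Suc (Suc (i div 2)) = j div 2 \<longrightarrow> nontriv (F (Suc (i div 2)))")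
      case True
      then show ?thesis using far ij by blast
    next
      case False
      then have e: "Suc (Suc (i div 2)) = j div 2" and nt: "\<not> nontriv (F (Suc (i div 2)))" by auto
      have "f i \<in> F (Suc (Suc (i div 2)))" using fF[of j] e ij(4) by simp
      then obtain y where y: "y \<in> F (Suc (i div 2))" "4 \<le> m (f i) y"
        and yt: "\<And>p. y \<in> F p \<Longrightarrow> y \<in> F (Suc (Suc p)) \<Longrightarrow> nontriv (F (Suc p))"
        using turn[OF fF] nt by blast
      obtain k where k: "k \<in> A" "k div 2 = Suc (i div 2)" "f k = y" using posn y by blast
      have "i < k" "k < j" using k(2) e by (auto intro: ccontr simp: not_less dest: div_le_mono[of _ _ 2])
      moreover have "adj (f i) y" using adjF fF y by blast
      moreover have "two_between A f i' j'" if t: "i' \<in> A" "j' \<in> A" "i' < j'" "f i' = y" "f j' = y" for i' j'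
      proof (rule far)
        assume "Suc (Suc (i' div 2)) = j' div 2"
        then show "nontriv (F (Suc (i' div 2)))" using yt fF[of i'] fF[of j'] t by simp
      qed (use t in auto)
      ultimately show ?thesis using k y by blast
    qed
  qed
qed

section \<open>Walks, cycles and bridges\<close>

text \<open>With singleton layers a letter recurs at distance two only by backtracking, so
  \<open>turn\<close> holds vacuously.\<close>

lemma infinite_walk:
  fixes x :: "nat \<Rightarrow> 's"
  assumes "\<And>i. adj (x i) (x (Suc i))" and "\<And>i. x i \<noteq> x (Suc (Suc i))"
  shows "infinitely_many_fc S m"
  using assms by (intro infinite_layers[of "\<lambda>i. {x i}"]) auto

text \<open>Running around the cycle forever is a walk without backtracking, because
  \<open>i\<close> and \<open>i + 2\<close> differ modulo \<open>n\<close> for \<open>n\<close> at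
  least 3.\<close>

lemma infinite_cycle:
  fixes x :: "nat \<Rightarrow> 's"
  assumes n: "3 \<le> n" and inj: "inj_on x {..<n}"
    and step: "\<And>i. Suc i < n \<Longrightarrow> adj (x i) (x (Suc i))" and close: "adj (x (n - 1)) (x 0)"
  shows "infinitely_many_fc S m"
proof (rule infinite_walk[of "\<lambda>i. x (i mod n)"])
  fix i
  have lt: "i mod n < n" using n by simp
  show "adj (x (i mod n)) (x (Suc i mod n))"
  proof (cases "Suc (i mod n) = n")
    case True
    then have "i mod n = n - 1" by simp
    then show ?thesis using True close by (simp add: mod_Suc)
  next
    case False
    then show ?thesis using lt step[of "i mod n"] by (simp add: mod_Suc)
  qed
  have "i mod n \<noteq> Suc (Suc i) mod n"
    using n lt by (auto simp: mod_Suc)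
  then show "x (i mod n) \<noteq> x (Suc (Suc i) mod n)"
    using inj lt n by (auto dest: inj_onD)
qed

text \<open>The first repetition of a vertex closes a cycle; irreflexivity and the lack of
  backtracking exclude lengths 1 and 2.\<close>

lemma infinite_closed_walk:
  fixes x :: "nat \<Rightarrow> 's"
  assumes step: "\<And>i. i < k \<Longrightarrow> adj (x i) (x (Suc i))"
    and nb: "\<And>i. Suc i < k \<Longrightarrow> x i \<noteq> x (Suc (Suc i))"
    and k: "0 < k" "x 0 = x k"
  shows "infinitely_many_fc S m"
proof -
  define j where "j = (LEAST j. \<exists>i<j. x i = x j)"
  have ex: "\<exists>i<k. x i = x k" using k by blast
  then have jk: "j \<le> k" unfolding j_def by (rule Least_le)
  have "\<exists>i<j. x i = x j" unfolding j_def by (rule LeastI[of "\<lambda>j. \<exists>i<j. x i = x j", OF ex])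
  then obtain i where i: "i < j" "x i = x j" by blast
  have min: "x a \<noteq> x b" if "a < b" "b < j" for a b
    using that not_less_Least[of b "\<lambda>j. \<exists>i<j. x i = x j"] by (auto simp: j_def)
  have "j \<noteq> Suc i" using i step[of i] jk adj_irrefl by auto
  moreover have "j \<noteq> Suc (Suc i)" using i nb[of i] jk by auto
  ultimately have n: "3 \<le> j - i" using i by linarith
  show ?thesis
  proof (rule infinite_cycle[OF n, of "\<lambda>l. x (i + l)"])
    show "inj_on (\<lambda>l. x (i + l)) {..<j - i}"
    proof (rule linorder_inj_onI')
      fix a b assume "a \<in> {..<j - i}" "b \<in> {..<j - i}" "a < b"
      then show "x (i + a) \<noteq> x (i + b)" using min[of "i + a" "i + b"] by auto
    qed
    show "adj (x (i + l)) (x (i + Suc l))" if "Suc l < j - i" for l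
      using step[of "i + l"] that jk by simp
    have "adj (x (j - 1)) (x j)" using step[of "j - 1"] jk i by simp
    then show "adj (x (i + (j - i - 1))) (x (i + 0))" using i by simp
  qed
qed

definition edges_but :: "'s \<Rightarrow> 's \<Rightarrow> 's rel" where
  "edges_but s t = {(x, y). adj x y} - {(s, t), (t, s)}"

text \<open>A walk that returns to a vertex of the path built so far is cut at that vertex.\<close>

lemma simple_path:
  assumes "(s, t) \<in> r\<^sup>*"
  shows "\<exists>x n. x 0 = s \<and> x n = t \<and> inj_on x {..n} \<and> (\<forall>i<n. (x i, x (Suc i)) \<in> r)"
  using assms
proof (induction rule: rtrancl_induct)
  case base
  show ?case by (intro exI[of _ "\<lambda>_. s"] exI[of _ 0]) auto
next
  case (step y z)
  then obtain x n where x: "x 0 = s" "x n = y" "inj_on x {..n}" "\<forall>i<n. (x i, x (Suc i)) \<in> r"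
    by blast
  show ?case
  proof (cases "\<exists>k\<le>n. x k = z")
    case True
    then obtain k where k: "k \<le> n" "x k = z" by blast
    have "inj_on x {..k}" using x(3) k(1) by (meson atMost_subset_iff inj_on_subset)
    then show ?thesis using x k by (intro exI[of _ x] exI[of _ k]) auto
  next
    case False
    define x' where "x' = x(Suc n := z)"
    have "inj_on x' {..Suc n}"
      using x(3) False by (auto simp: x'_def inj_on_def le_Suc_eq)
    moreover have "\<forall>i<Suc n. (x' i, x' (Suc i)) \<in> r"
      using x step.hyps(2) by (auto simp: x'_def less_Suc_eq)
    moreover have "x' 0 = s" "x' (Suc n) = z" using x(1) by (simp_all add: x'_def)
    ultimately show ?thesis by blast
  qed
qed

text \<open>A simple path avoiding the edge closes up with it to a cycle. The path has length at
  least 2, since \<open>s\<close> and \<open>t\<close> differ and the edge itself is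
  removed.\<close>

lemma infinite_if_not_bridge:
  assumes st: "adj s t" and path: "(s, t) \<in> (edges_but s t)\<^sup>*"
  shows "infinitely_many_fc S m"
proof -
  obtain x n where x: "x 0 = s" "x n = t" "inj_on x {..n}" "\<forall>i<n. (x i, x (Suc i)) \<in> edges_but s t"
    using simple_path[OF path] by blast
  have "n \<noteq> 0" using x(1,2) st adj_irrefl by metis
  moreover have "n \<noteq> 1" using x by (auto simp: edges_but_def)
  ultimately have "3 \<le> Suc n" by simp
  then show ?thesis
  proof (rule infinite_cycle[of _ x])
    show "inj_on x {..<Suc n}" using x(3) by (simp add: lessThan_Suc_atMost)
    show "adj (x i) (x (Suc i))" if "Suc i < Suc n" for i
      using x(4) that by (auto simp: edges_but_def)
    show "adj (x (Suc n - 1)) (x 0)" using x st adj_sym by simp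
  qed
qed

section \<open>Zigzags\<close>

text \<open>The flag is the direction of travel, \<open>True\<close> being upwards.\<close>

primrec bounce :: "nat \<Rightarrow> nat \<Rightarrow> nat \<times> bool" where
  "bounce n 0 = (0, True)"
| "bounce n (Suc i) = (case bounce n i of (k, up) \<Rightarrow>
     if up then (if Suc k < n then (Suc k, True) else (n, False))
     else (if 1 < k then (k - 1, False) else (0, True)))"

lemma bounce_range:
  "0 < n \<Longrightarrow> case bounce n i of (k, up) \<Rightarrow> (if up then k < n else 0 < k \<and> k \<le> n)"
  by (induction i) (auto split: prod.splits if_splits)

text \<open>Three consecutive levels are monotone or turn at an end. For \<open>n = 1\<close> every
  step turns.\<close>

lemma bounce_cases [consumes 1, case_names up down bottom top]:
  assumes "0 < n"
  obtains
    (up) k where "Suc (Suc k) \<le> n" "fst (bounce n i) = k" "fst (bounce n (Suc i)) = Suc k"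
      "fst (bounce n (Suc (Suc i))) = Suc (Suc k)"
  | (down) k where "Suc (Suc k) \<le> n" "fst (bounce n i) = Suc (Suc k)" "fst (bounce n (Suc i)) = Suc k"
      "fst (bounce n (Suc (Suc i))) = k"
  | (bottom) "fst (bounce n i) = 1" "fst (bounce n (Suc i)) = 0" "fst (bounce n (Suc (Suc i))) = 1"
  | (top) "fst (bounce n i) = n - 1" "fst (bounce n (Suc i)) = n"
      "fst (bounce n (Suc (Suc i))) = n - 1"
proof -
  obtain k u where b: "bounce n i = (k, u)" by fastforce
  have r: "if u then k < n else 0 < k \<and> k \<le> n" using bounce_range[OF assms, of i] b by simp
  then have "u \<and> Suc (Suc k) \<le> n \<or> u \<and> Suc k = n \<or> \<not> u \<and> 1 < k \<or> \<not> u \<and> k = 1"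
    by (cases u) auto
  then consider "u" "Suc (Suc k) \<le> n" | "u" "Suc k = n" | "\<not> u" "1 < k" | "\<not> u" "k = 1"
    by blast
  then show thesis
  proof cases
    case 1
    then show ?thesis using up[of k] b by (cases "Suc (Suc k) = n") auto
  next
    case 2
    then show ?thesis using top bottom b by (cases "n = 1") auto
  next
    case 3
    then have "k = Suc (Suc (k - 2))" by simp
    then show ?thesis using down[of "k - 2"] b 3 r by (cases "k = 2") auto
  next
    case 4
    then show ?thesis using bottom top b r by (cases "n = 1") auto
  qed
qed

declare bounce.simps [simp del]

text \<open>The levels \<open>Q\<close>, visited as in \<open>bounce\<close>, serve as layers. By
  \<open>disj\<close> a letter recurs two layers later only where the walk turns, and there
  \<open>bot\<close> and \<open>top\<close> supply the fork or the label at least 4.\<close>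

lemma infinite_zigzag:
  fixes Q :: "nat \<Rightarrow> 's set"
  assumes n: "2 \<le> n"
    and single: "\<And>k. 0 < k \<Longrightarrow> k < n \<Longrightarrow> \<exists>x. Q k = {x}"
    and ends: "\<exists>x y. Q 0 = {x, y}" "\<exists>x y. Q n = {x, y}"
    and adjQ: "\<And>k x y. k < n \<Longrightarrow> x \<in> Q k \<Longrightarrow> y \<in> Q (Suc k) \<Longrightarrow> adj x y"
    and disj: "\<And>k. Suc k < n \<Longrightarrow> Q k \<inter> Q (Suc (Suc k)) = {}"
    and bot: "nontriv (Q 0) \<or> (\<exists>x\<in>Q 1. \<exists>y\<in>Q 0. 4 \<le> m x y)"
    and top: "nontriv (Q n) \<or> (\<exists>x\<in>Q (n - 1). \<exists>y\<in>Q n. 4 \<le> m x y)"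
  shows "infinitely_many_fc S m"
proof (rule ccontr)
  assume fin: "\<not> infinitely_many_fc S m"
  define F where "F i = Q (fst (bounce n i))" for i
  have n0: "0 < n" using n by simp
  have shape: "\<exists>x y. Q k = {x, y}" if "k \<le> n" for k
    using single[of k] ends that by (metis insert_absorb2 le_neq_implies_less not_gr_zero)
  have mem: "\<exists>x. x \<in> Q k" if "k \<le> n" for k
    using shape[OF that] by blast
  have subsing: "x = y" if "\<not> nontriv X" "x \<in> X" "y \<in> X" for x y and X :: "'s set"
    using that unfolding nontriv_def by blast
  \<comment> \<open>If the levels from \<open>i\<close> to \<open>j\<close> are singletons, a letter
    common to levels \<open>i\<close> and \<open>j\<close> closes a walk without backtracking, which
    \<open>fin\<close> excludes.\<close>
  have far: "False" if "i < j" "j \<le> n" "y \<in> Q i" "y \<in> Q j" and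
    nt: "\<And>k. i \<le> k \<Longrightarrow> k \<le> j \<Longrightarrow> \<not> nontriv (Q k)" for i j y
  proof -
    define x where "x k = (SOME z. z \<in> Q (i + k))" for k
    have x: "x k \<in> Q (i + k)" if "k \<le> j - i" for k
    proof -
      have "i + k \<le> n" using that \<open>i < j\<close> \<open>j \<le> n\<close> by linarith
      then show ?thesis unfolding x_def by (rule someI_ex[OF mem])
    qed
    have "infinitely_many_fc S m"
    proof (rule infinite_closed_walk)
      fix k assume k: "k < j - i"
      then have "x k \<in> Q (i + k)" "x (Suc k) \<in> Q (Suc (i + k))"
        using x[of k] x[of "Suc k"] by simp_all
      moreover have "i + k < n" using k \<open>j \<le> n\<close> by linarith
      ultimately show "adj (x k) (x (Suc k))" using adjQ by blast
    next
      fix k assume k: "Suc k < j - i"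
      then have "x k \<in> Q (i + k)" "x (Suc (Suc k)) \<in> Q (Suc (Suc (i + k)))"
        using x[of k] x[of "Suc (Suc k)"] by simp_all
      moreover have "Suc (i + k) < n" using k \<open>j \<le> n\<close> by linarith
      ultimately show "x k \<noteq> x (Suc (Suc k))" using disj[of "i + k"] by auto
    next
      show "0 < j - i" using that by simp
      show "x 0 = x (j - i)"
      proof -
        have "x 0 \<in> Q i" "x (j - i) \<in> Q j" using x[of 0] x[of "j - i"] that(1) by simp_all
        moreover have "\<not> nontriv (Q i)" "\<not> nontriv (Q j)" using that(1) by (simp_all add: nt)
        ultimately have "x 0 = y" "x (j - i) = y" using subsing that(3,4) by blast+
        then show ?thesis by simp
      qed
    qed
    then show False using fin by simp
  qed
  have nts: "\<not> nontriv (Q k)" if "0 < k" "k < n" for k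
    using single[OF that] by (auto simp: nontriv_def)
  have "infinitely_many_fc S m"
  proof (rule infinite_layers[of F])
    fix i
    have "fst (bounce n i) \<le> n" using bounce_range[OF n0, of i] by (auto split: if_splits)
    then show "\<exists>x y. F i = {x, y}"
      using shape by (simp add: F_def)
  next
    fix i x y assume x: "x \<in> F i" and y: "y \<in> F (Suc i)"
    show "adj x y"
      using n0
    proof (cases rule: bounce_cases[of n i])
      case (up k)
      then show ?thesis using x y adjQ[of k x y] by (simp add: F_def)
    next
      case (down k)
      then show ?thesis using x y adjQ[of "Suc k" y x] by (simp add: F_def adj_sym[of y x])
    next
      case bottom
      then show ?thesis using x y adjQ[of 0 y x] n by (simp add: F_def adj_sym[of y x])
    next
      case top
      then show ?thesis using x y adjQ[of "n - 1" x y] n by (simp add: F_def)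
    qed
  next
    fix i x assume x: "x \<in> F i" "x \<in> F (Suc (Suc i))"
    have turnpt: "(fst (bounce n i) = 1 \<and> fst (bounce n (Suc i)) = 0) \<or>
      (fst (bounce n i) = n - 1 \<and> fst (bounce n (Suc i)) = n)"
      if "z \<in> F i" "z \<in> F (Suc (Suc i))" for i z
      using n0
    proof (cases rule: bounce_cases[of n i])
      case (up k)
      then show ?thesis using that disj[of k] by (auto simp: F_def)
    next
      case (down k)
      then show ?thesis using that disj[of k] by (auto simp: F_def)
    qed auto
    show "nontriv (F (Suc i)) \<or> (\<exists>y\<in>F (Suc i). 4 \<le> m x y \<and>
         (\<forall>j. y \<in> F j \<and> y \<in> F (Suc (Suc j)) \<longrightarrow> nontriv (F (Suc j))))"
    proof (cases "nontriv (F (Suc i))")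
      case nt: False
      from turnpt[OF x] show ?thesis
      proof
        assume e: "fst (bounce n i) = 1 \<and> fst (bounce n (Suc i)) = 0"
        then have nt0: "\<not> nontriv (Q 0)" and x1: "x \<in> Q 1" using nt x by (simp_all add: F_def)
        then obtain y where y: "y \<in> Q 0" "4 \<le> m x y"
          using bot subsing[OF nts[of 1]] n by (metis Suc_1 Suc_le_lessD zero_less_one)
        \<comment> \<open>In fact \<open>y\<close> never recurs two layers apart: around level 0 it
          would be adjacent to itself, and around level \<open>n\<close> it would lie in both
          \<open>Q 0\<close> and \<open>Q (n - 1)\<close>, against \<open>far\<close>.\<close>
        have "nontriv (F (Suc j))" if j: "y \<in> F j" "y \<in> F (Suc (Suc j))" for j
          using turnpt[OF j]
        proof
          assume "fst (bounce n j) = 1 \<and> fst (bounce n (Suc j)) = 0"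
          then have "adj y y" using j y adjQ[of 0 y y] n by (simp add: F_def)
          then show ?thesis using adj_irrefl by simp
        next
          assume t: "fst (bounce n j) = n - 1 \<and> fst (bounce n (Suc j)) = n"
          have "\<not> nontriv (Q k)" if "k \<le> n - 1" for k
            using nt0 nts[of k] that n by (cases "k = 0") auto
          then have False using far[of 0 "n - 1" y] y j t n by (simp add: F_def)
          then show ?thesis ..
        qed
        then show ?thesis using y e by (auto simp: F_def)
      next
        assume e: "fst (bounce n i) = n - 1 \<and> fst (bounce n (Suc i)) = n"
        then have ntn: "\<not> nontriv (Q n)" and x1: "x \<in> Q (n - 1)" using nt x by (simp_all add: F_def)
        then obtain y where y: "y \<in> Q n" "4 \<le> m x y"
          using top subsing[OF nts[of "n - 1"]] n by (metis Suc_1 Suc_le_lessD diff_less n0 zero_less_diff zero_less_one)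
        have "nontriv (F (Suc j))" if j: "y \<in> F j" "y \<in> F (Suc (Suc j))" for j
          using turnpt[OF j]
        proof
          assume "fst (bounce n j) = 1 \<and> fst (bounce n (Suc j)) = 0"
          then have y1: "y \<in> Q 1" using j by (simp add: F_def)
          have "\<not> nontriv (Q k)" if "1 \<le> k" "k \<le> n" for k
            using ntn nts[of k] that by (cases "k = n") auto
          then have False using far[of 1 n y] y y1 n by simp
          then show ?thesis ..
        next
          assume t: "fst (bounce n j) = n - 1 \<and> fst (bounce n (Suc j)) = n"
          then have "adj y y" using j y adjQ[of "n - 1" y y] n by (simp add: F_def)
          then show ?thesis using adj_irrefl by simp
        qed
        then show ?thesis using y e by (auto simp: F_def)
      qed
    qed simp
  qed
  then show False using fin by simp
qed

section \<open>Arms with reflecting ends\<close>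

text \<open>A path leaving \<open>s\<close> through \<open>t\<close> whose end reflects a zigzag: the end is a fork or an edge
  with label at least \<open>4\<close>.\<close>

definition arm :: "'s \<Rightarrow> 's \<Rightarrow> (nat \<Rightarrow> 's set) \<Rightarrow> nat \<Rightarrow> bool" where
  "arm s t h n \<longleftrightarrow> 2 \<le> n \<and> h 0 = {s} \<and> h 1 = {t} \<and>
     (\<forall>k<n. \<exists>x. h k = {x}) \<and> (\<exists>x y. h n = {x, y}) \<and>
     (\<forall>k<n. \<forall>x\<in>h k. \<forall>y\<in>h (Suc k). adj x y) \<and>
     (\<forall>k. Suc k < n \<longrightarrow> h k \<inter> h (Suc (Suc k)) = {}) \<and>
     (nontriv (h n) \<or> (\<exists>x\<in>h (n - 1). \<exists>y\<in>h n. 4 \<le> m x y))"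

text \<open>The shortest arms: a fork at \<open>t\<close> if \<open>v\<close> and \<open>v'\<close>
  differ, otherwise an edge with label at least 4.\<close>

lemma arm_end:
  assumes "adj s t" "adj t v" "adj t v'" "v \<noteq> s" "v' \<noteq> s" "v \<noteq> v' \<or> 4 \<le> m t v"
  shows "\<exists>h n. arm s t h n"
proof -
  define h where "h k = (if k = 0 then {s} else if k = 1 then {t} else {v, v'})" for k :: nat
  have "arm s t h 2"
    unfolding arm_def
  proof (intro conjI allI impI ballI)
    show "\<exists>x. h k = {x}" if "k < 2" for k using that by (auto simp: h_def less_2_cases_iff)
    show "\<exists>x y. h 2 = {x, y}" by (auto simp: h_def)
    show "adj x y" if "k < 2" "x \<in> h k" "y \<in> h (Suc k)" for k x y
      using that assms(1-3) by (auto simp: h_def less_2_cases_iff)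
    show "h k \<inter> h (Suc (Suc k)) = {}" if "Suc k < 2" for k
      using that assms(4,5) by (auto simp: h_def)
    show "nontriv (h 2) \<or> (\<exists>x\<in>h (2 - 1). \<exists>y\<in>h 2. 4 \<le> m x y)"
      using assms(6) by (auto simp: h_def nontriv_def)
  qed (simp_all add: h_def)
  then show ?thesis by blast
qed

text \<open>Put \<open>s\<close> in front of the arm; \<open>v \<noteq> s\<close> keeps the longer
  path from turning back at \<open>t\<close>.\<close>

lemma arm_step:
  assumes st: "adj s t" and v: "v \<noteq> s" and h: "arm t v h n"
  shows "\<exists>h n. arm s t h n"
proof -
  define h' where "h' = case_nat {s} h"
  have n: "2 \<le> n" "h 0 = {t}" "h 1 = {v}" using h by (simp_all add: arm_def)
  have "arm s t h' (Suc n)"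
    unfolding arm_def
  proof (intro conjI allI impI)
    show "2 \<le> Suc n" "h' 0 = {s}" "h' 1 = {t}" using n by (simp_all add: h'_def)
    show "\<exists>x. h' k = {x}" if "k < Suc n" for k
      using h that by (cases k) (auto simp: h'_def arm_def)
    show "\<exists>x y. h' (Suc n) = {x, y}" using h by (simp add: h'_def arm_def)
    show "\<forall>x\<in>h' k. \<forall>y\<in>h' (Suc k). adj x y" if "k < Suc n" for k
      using h that st by (cases k) (auto simp: h'_def arm_def)
    show "h' k \<inter> h' (Suc (Suc k)) = {}" if "Suc k < Suc n" for k
      using h that v by (cases k) (auto simp: h'_def arm_def)
    have "h' (Suc n - 1) = h (n - 1)" using n(1) by (cases n) (auto simp: h'_def)
    then show "nontriv (h' (Suc n)) \<or> (\<exists>x\<in>h' (Suc n - 1). \<exists>y\<in>h' (Suc n). 4 \<le> m x y)"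
      using h by (simp add: h'_def arm_def)
  qed
  then show ?thesis by blast
qed

text \<open>The first arm read backwards and then the second form a path between two reflecting
  ends; \<open>t \<noteq> u\<close> prevents a turn at \<open>s\<close>.\<close>

lemma infinite_two_arms:
  assumes a1: "arm s t h1 n1" and a2: "arm s u h2 n2" and tu: "t \<noteq> u"
  shows "infinitely_many_fc S m"
proof (rule infinite_zigzag)
  define Q where "Q k = (if k \<le> n1 then h1 (n1 - k) else h2 (k - n1))" for k
  have n: "2 \<le> n1" "2 \<le> n2" using a1 a2 by (simp_all add: arm_def)
  have h0: "h1 0 = {s}" "h2 0 = {s}" "h1 1 = {t}" "h2 1 = {u}" using a1 a2 by (simp_all add: arm_def)
  have Q2: "Q k = h2 (k - n1)" if "n1 \<le> k" for k using that h0 by (auto simp: Q_def)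
  have Q1: "Q k = h1 (n1 - k)" if "k \<le> n1" for k using that by (simp add: Q_def)
  show "2 \<le> n1 + n2" using n by simp
  show "\<exists>x. Q k = {x}" if "0 < k" "k < n1 + n2" for k
  proof (cases "k \<le> n1")
    case True
    then have "n1 - k < n1" using that by simp
    then show ?thesis using a1 Q1[OF True] by (simp add: arm_def)
  next
    case False
    then have "k - n1 < n2" using that by simp
    then show ?thesis using a2 Q2[of k] False by (simp add: arm_def)
  qed
  show "\<exists>x y. Q 0 = {x, y}" using a1 by (simp add: Q1 arm_def)
  show "\<exists>x y. Q (n1 + n2) = {x, y}" using a2 by (simp add: Q2 arm_def)
  show "adj x y" if "k < n1 + n2" "x \<in> Q k" "y \<in> Q (Suc k)" for k x y
  proof (cases "k < n1")
    case True
    then have k: "n1 - k = Suc (n1 - Suc k)" "n1 - Suc k < n1" by simp_all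
    have "y \<in> h1 (n1 - Suc k)" using that(3) True by (simp add: Q1)
    moreover have "x \<in> h1 (Suc (n1 - Suc k))" using that(2) Q1[of k] True k(1) by (metis less_imp_le)
    ultimately have "adj y x" using a1 k(2) unfolding arm_def by blast
    then show ?thesis by (rule adj_sym)
  next
    case False
    then have "Suc k - n1 = Suc (k - n1)" "k - n1 < n2" using that by simp_all
    then show ?thesis using a2 that False Q2[of k] Q2[of "Suc k"] by (simp add: arm_def)
  qed
  show "Q k \<inter> Q (Suc (Suc k)) = {}" if "Suc k < n1 + n2" for k
  proof -
    consider "Suc (Suc k) \<le> n1" | "Suc k = n1" | "n1 \<le> k" by linarith
    then show ?thesis
    proof cases
      case 1
      then have "n1 - k = Suc (Suc (n1 - Suc (Suc k)))" "Suc (n1 - Suc (Suc k)) < n1" by simp_all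
      then show ?thesis using a1 1 Q1[of k] Q1[of "Suc (Suc k)"] by (auto simp: arm_def)
    next
      case 2
      then have "n1 - k = 1" "Suc (Suc k) - n1 = 1" by simp_all
      then show ?thesis using 2 Q1[of k] Q2[of "Suc (Suc k)"] h0 tu by simp
    next
      case 3
      then have "Suc (Suc k) - n1 = Suc (Suc (k - n1))" "Suc (k - n1) < n2" using that by simp_all
      then show ?thesis using a2 3 Q2[of k] Q2[of "Suc (Suc k)"] by (simp add: arm_def)
    qed
  qed
  show "nontriv (Q 0) \<or> (\<exists>x\<in>Q 1. \<exists>y\<in>Q 0. 4 \<le> m x y)"
  proof -
    have "Q 0 = h1 n1" "Q 1 = h1 (n1 - 1)" using n by (simp_all add: Q1)
    then show ?thesis using a1 unfolding arm_def by metis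
  qed
  have "Q (n1 + n2 - 1) = h2 (n2 - 1)" "Q (n1 + n2) = h2 n2" using n by (simp_all add: Q2)
  then show "nontriv (Q (n1 + n2)) \<or> (\<exists>x\<in>Q (n1 + n2 - 1). \<exists>y\<in>Q (n1 + n2). 4 \<le> m x y)"
    using a2 unfolding arm_def by metis
qed

end

section \<open>Heaps over a forest\<close>

locale finite_fc_heap = coxeter_graph S m
  for S :: "'s set" and m :: "'s \<Rightarrow> 's \<Rightarrow> enat" +
  fixes E :: "'a set" and le :: "'a rel" and lab :: "'a \<Rightarrow> 's"
  assumes heap: "fc_heap S m E le lab" and not_infinite: "\<not> infinitely_many_fc S m"
begin

section \<open>The order and its covering relations\<close>

abbreviation lt :: "'a \<Rightarrow> 'a \<Rightarrow> bool" where "lt \<equiv> less_in le"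

lemma labelled: "labelled_heap S m E le lab"
  using heap by (simp add: fc_heap_def)

lemma finE: "finite E" and le_E: "(x, y) \<in> le \<Longrightarrow> x \<in> E \<and> y \<in> E"
  and le_refl: "x \<in> E \<Longrightarrow> (x, x) \<in> le" and le_trans: "(x, y) \<in> le \<Longrightarrow> (y, z) \<in> le \<Longrightarrow> (x, z) \<in> le"
  and le_antisym: "(x, y) \<in> le \<Longrightarrow> (y, x) \<in> le \<Longrightarrow> x = y"
  and lab_S: "x \<in> E \<Longrightarrow> lab x \<in> S"
  using labelled
  unfolding labelled_heap_def partial_order_on_def preorder_on_def refl_on_def trans_def antisym_def
  by blast+

lemma le_trancl: "le = {(x, y). (x, y) \<in> le \<and> concur m (lab x) (lab y)}\<^sup>+"
  using labelled unfolding labelled_heap_def by blast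

lemma comparable:
  "x \<in> E \<Longrightarrow> y \<in> E \<Longrightarrow> lab x = lab y \<or> adj (lab x) (lab y) \<Longrightarrow> x = y \<or> lt x y \<or> lt y x"
  using labelled concur_refl lab_S unfolding labelled_heap_def less_in_def adj_def by metis

lemma lt_E: "lt x y \<Longrightarrow> x \<in> E \<and> y \<in> E"
  using le_E by (auto simp: less_in_def)

lemma lt_trans: "lt x y \<Longrightarrow> lt y z \<Longrightarrow> lt x z"
  using le_trans le_antisym unfolding less_in_def by metis

lemma lt_irrefl: "\<not> lt x x"
  by (simp add: less_in_def)

lemma le_lt: "(x, y) \<in> le \<longleftrightarrow> lt x y \<or> (x = y \<and> x \<in> E)"
  using le_E le_refl by (auto simp: less_in_def)

lemma finite_between: "finite {w. lt x w \<and> lt w y}"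
proof (rule finite_subset[OF _ finE])
  show "{w. lt x w \<and> lt w y} \<subseteq> E" using lt_E by blast
qed

lemma card_between_left:
  assumes "lt x z" "lt z y"
  shows "card {w. lt x w \<and> lt w z} < card {w. lt x w \<and> lt w y}"
proof (rule psubset_card_mono[OF finite_between])
  have "{w. lt x w \<and> lt w z} \<subseteq> {w. lt x w \<and> lt w y}" using lt_trans[OF _ assms(2)] by blast
  moreover have "z \<in> {w. lt x w \<and> lt w y} - {w. lt x w \<and> lt w z}" using assms lt_irrefl by simp
  ultimately show "{w. lt x w \<and> lt w z} \<subset> {w. lt x w \<and> lt w y}" by blast
qed

lemma card_between_right:
  assumes "lt x z" "lt z y"
  shows "card {w. lt z w \<and> lt w y} < card {w. lt x w \<and> lt w y}"
proof (rule psubset_card_mono[OF finite_between])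
  have "{w. lt z w \<and> lt w y} \<subseteq> {w. lt x w \<and> lt w y}" using lt_trans[OF assms(1)] by blast
  moreover have "z \<in> {w. lt x w \<and> lt w y} - {w. lt z w \<and> lt w y}" using assms lt_irrefl by simp
  ultimately show "{w. lt z w \<and> lt w y} \<subset> {w. lt x w \<and> lt w y}" by blast
qed

lemma lt_cover_above: "lt x y \<Longrightarrow> \<exists>z. covers le x z \<and> (z, y) \<in> le"
proof (induction "card {z. lt x z \<and> lt z y}" arbitrary: y rule: less_induct)
  case less
  show ?case
  proof (cases "covers le x y")
    case True
    then show ?thesis using less.prems lt_E le_refl by blast
  next
    case False
    then obtain z where z: "lt x z" "lt z y" using less.prems by (auto simp: covers_def)
    then obtain w where "covers le x w" "(w, z) \<in> le"
      using less.hyps[OF card_between_left[OF z] z(1)] by blast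
    then show ?thesis using z(2) le_trans by (meson less_in_def)
  qed
qed

lemma lt_cover_below: "lt x y \<Longrightarrow> \<exists>z. (x, z) \<in> le \<and> covers le z y"
proof (induction "card {z. lt x z \<and> lt z y}" arbitrary: x rule: less_induct)
  case less
  show ?case
  proof (cases "covers le x y")
    case True
    then show ?thesis using less.prems lt_E le_refl by blast
  next
    case False
    then obtain z where z: "lt x z" "lt z y" using less.prems by (auto simp: covers_def)
    then obtain w where "(z, w) \<in> le" "covers le w y"
      using less.hyps[OF card_between_right[OF z] z(2)] by blast
    then show ?thesis using z(1) le_trans by (meson less_in_def)
  qed
qed

text \<open>The order is generated by its pairs whose labels satisfy \<open>concur\<close>. In a
  generating chain from \<open>x\<close> to \<open>y\<close>, the first step that is not a loop must
  already end at \<open>y\<close>. Full commutativity excludes equal labels.\<close>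

lemma cover_adj:
  assumes "covers le x y"
  shows "adj (lab x) (lab y)"
proof -
  let ?r = "{(x, y). (x, y) \<in> le \<and> concur m (lab x) (lab y)}"
  have xy: "lt x y" using assms by (simp add: covers_def)
  then have "(x, y) \<in> ?r\<^sup>+" using le_trancl by (auto simp: less_in_def)
  then have "x \<noteq> y \<longrightarrow> (\<exists>z. (x, z) \<in> ?r \<and> x \<noteq> z \<and> (z, y) \<in> le)"
  proof (induction rule: converse_trancl_induct)
    case (base x)
    then show ?case using le_E le_refl by blast
  next
    case (step x z)
    then have "(z, y) \<in> le" using le_trancl by blast
    then show ?case using step by (cases "x = z") auto
  qed
  then obtain z where "(x, z) \<in> ?r" "x \<noteq> z" "(z, y) \<in> le" using xy lt_irrefl by blast
  moreover have "z = y" using calculation assms unfolding covers_def less_in_def by blast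
  ultimately have "concur m (lab x) (lab y)" by simp
  moreover have "lab x \<noteq> lab y" using heap assms by (auto simp: fc_heap_def)
  ultimately show ?thesis using xy lt_E lab_S by (auto simp: adj_def)
qed

text \<open>An edge that is not a bridge lies on a cycle, so the Coxeter graph is a forest.\<close>

lemma bridge: "adj s t \<Longrightarrow> (s, t) \<notin> (edges_but s t)\<^sup>*"
  using infinite_if_not_bridge not_infinite by blast

text \<open>Otherwise the labels along a saturated chain from \<open>x\<close> to \<open>y\<close> join the two labels while
  avoiding the edge between them.\<close>

lemma coversI:
  assumes xy: "lt x y" and ad: "adj (lab x) (lab y)"
    and no: "\<And>z. lt x z \<Longrightarrow> lt z y \<Longrightarrow> lab z \<noteq> lab x \<and> lab z \<noteq> lab y"
  shows "covers le x y"
proof (rule ccontr)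
  let ?r = "{(x, y). (x, y) \<in> le \<and> concur m (lab x) (lab y)}"
  let ?R = "edges_but (lab x) (lab y)"
  assume "\<not> covers le x y"
  then obtain z where z: "lt x z" "lt z y" using xy by (auto simp: covers_def)
  have ends: "p = x \<or> p = y" if "(x, p) \<in> le" "(p, y) \<in> le" "lab p = lab x \<or> lab p = lab y" for p
    using no[of p] that unfolding le_lt by blast
  \<comment> \<open>By \<open>ends\<close>, a step using the removed edge would go from
    \<open>x\<close> to \<open>y\<close> directly. This is why the chain is cut at \<open>z\<close>
    below.\<close>
  have one: "(lab p, lab q) \<in> ?R\<^sup>*"
    if "(p, q) \<in> ?r" "(x, p) \<in> le" "(q, y) \<in> le" "\<not> (p = x \<and> q = y)" for p q
  proof (cases "lab p = lab q")
    case False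
    have pq: "(p, q) \<in> le" using that(1) by simp
    then have "adj (lab p) (lab q)" using that(1) False le_E lab_S by (auto simp: adj_def)
    moreover have "(p, y) \<in> le" "(x, q) \<in> le" using that pq le_trans by blast+
    then have "(lab p, lab q) \<notin> {(lab x, lab y), (lab y, lab x)}"
      using ends[of p] ends[of q] that pq False le_antisym xy by (auto simp: less_in_def)
    ultimately show ?thesis by (auto simp: edges_but_def)
  qed simp
  have many: "(lab p, lab q) \<in> ?R\<^sup>*"
    if "(p, q) \<in> ?r\<^sup>+" "(x, p) \<in> le" "(q, y) \<in> le" "\<not> (p = x \<and> q = y)" for p q
    using that
  proof (induction rule: trancl_induct)
    case (base q)
    then show ?case using one by blast
  next
    case (step q' q)
    have pq': "(p, q') \<in> le" using step.hyps(1) le_trancl by blast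
    have q'q: "(q', q) \<in> le" using step.hyps(2) by simp
    have q'y: "(q', y) \<in> le" and xq': "(x, q') \<in> le"
      using le_trans q'q pq' step.prems by blast+
    have "\<not> (p = x \<and> q' = y)" using step.prems q'q le_antisym by blast
    then have "(lab p, lab q') \<in> ?R\<^sup>*" using step.IH step.prems q'y by blast
    moreover have "\<not> (q' = x \<and> q = y)" using step.prems pq' le_antisym by blast
    then have "(lab q', lab q) \<in> ?R\<^sup>*" using one step.hyps(2) step.prems xq' by blast
    ultimately show ?case by (rule rtrancl_trans)
  qed
  have "(x, z) \<in> ?r\<^sup>+" "(z, y) \<in> ?r\<^sup>+"
    using z le_trancl by (auto simp: less_in_def)
  moreover have "(x, x) \<in> le" "(y, y) \<in> le" using xy lt_E le_refl by blast+
  ultimately have "(lab x, lab z) \<in> ?R\<^sup>*" "(lab z, lab y) \<in> ?R\<^sup>*"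
    using many[of x z] many[of z y] z by (auto simp: less_in_def)
  then show False using bridge[OF ad] by (meson rtrancl_trans)
qed

section \<open>Minimal balanced subintervals\<close>

abbreviation adjacents :: "'a \<Rightarrow> 'a \<Rightarrow> 'a set" where
  "adjacents \<equiv> adjacent_pieces m le lab"

lemma adjacents_iff:
  assumes "minimal_balanced le lab a b"
  shows "c \<in> adjacents a b \<longleftrightarrow> lt a c \<and> lt c b \<and> adj (lab a) (lab c)"
  using assms lab_S le_lt
  by (auto simp: adjacent_pieces_def interval_def minimal_balanced_def adj_def dest: lt_E)

lemma minimal_balancedD:
  assumes "minimal_balanced le lab a b"
  shows "lt a b" "lab a = lab b" "\<And>c. lt a c \<Longrightarrow> lt c b \<Longrightarrow> lab c \<noteq> lab a"
  using assms by (auto simp: minimal_balanced_def less_in_def interval_def)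

lemma minimal_balancedI:
  assumes "lt a b" "lab a = lab b" "\<And>c. lt a c \<Longrightarrow> lt c b \<Longrightarrow> lab c \<noteq> lab a"
  shows "minimal_balanced le lab a b"
  using assms by (auto simp: minimal_balanced_def less_in_def interval_def)

text \<open>Apart from \<open>c\<close>, nothing strictly between \<open>a\<close> and
  \<open>b\<close> has the label of \<open>a\<close> or of \<open>c\<close>, so
  \<open>coversI\<close> applies on both sides. A rank function then rises by exactly 2 from
  \<open>a\<close> to \<open>b\<close>.\<close>

lemma unique_adjacent_covers:
  assumes mb: "minimal_balanced le lab a b" and c: "c \<in> adjacents a b"
    and uniq: "\<And>d. d \<in> adjacents a b \<Longrightarrow> lab d = lab c \<Longrightarrow> d = c"
  shows "covers le a c" "covers le c b"
proof -
  note c' = c[unfolded adjacents_iff[OF mb]]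
  note D = minimal_balancedD[OF mb]
  have no: "lab z \<noteq> lab a \<and> lab z \<noteq> lab c" if "lt a z" "lt z b" "z \<noteq> c" for z
  proof
    show "lab z \<noteq> lab a" using D(3) that by blast
    show "lab z \<noteq> lab c" using uniq[of z] that c' by (auto simp: adjacents_iff[OF mb])
  qed
  show "covers le a c"
  proof (rule coversI)
    show "lt a c" "adj (lab a) (lab c)" using c' by simp_all
    show "lab z \<noteq> lab a \<and> lab z \<noteq> lab c" if "lt a z" "lt z c" for z
    proof (rule no)
      show "lt z b" using lt_trans[OF that(2)] c' by blast
    qed (use that lt_irrefl in auto)
  qed
  show "covers le c b"
  proof (rule coversI)
    show "lt c b" using c' by simp
    show "adj (lab c) (lab b)" using c' D(2) adj_sym by simp
    show "lab z \<noteq> lab c \<and> lab z \<noteq> lab b" if "lt c z" "lt z b" for z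
    proof -
      have "lt a z" using lt_trans[OF _ that(1)] c' by blast
      moreover have "z \<noteq> c" using that lt_irrefl by auto
      ultimately show ?thesis using no[of z] that(2) D(2) by simp
    qed
  qed
qed

text \<open>Inside the interval, elements covering \<open>a\<close> or covered by \<open>b\<close>
  are adjacent pieces by \<open>cover_adj\<close>. The interior is nonempty because
  \<open>b\<close>, having the label of \<open>a\<close>, does not cover it.\<close>

lemma adjacents_cover:
  assumes mb: "minimal_balanced le lab a b"
  shows "lt a z \<Longrightarrow> lt z b \<Longrightarrow> \<exists>c\<in>adjacents a b. (c, z) \<in> le"
    and "lt a z \<Longrightarrow> lt z b \<Longrightarrow> \<exists>c\<in>adjacents a b. (z, c) \<in> le"
    and "adjacents a b \<noteq> {}"
proof -
  note D = minimal_balancedD[OF mb]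
  show 1: "\<exists>c\<in>adjacents a b. (c, z) \<in> le" if "lt a z" "lt z b" for z
  proof -
    obtain c where c: "covers le a c" "(c, z) \<in> le" using lt_cover_above \<open>lt a z\<close> by blast
    then have "lt a c" "adj (lab a) (lab c)" using cover_adj by (auto simp: covers_def)
    moreover have "lt c b" using c(2) \<open>lt z b\<close> lt_trans by (auto simp: le_lt)
    ultimately show ?thesis using c adjacents_iff[OF mb] by blast
  qed
  show "\<exists>c\<in>adjacents a b. (z, c) \<in> le" if "lt a z" "lt z b" for z
  proof -
    obtain c where c: "covers le c b" "(z, c) \<in> le" using lt_cover_below \<open>lt z b\<close> by blast
    then have "lt c b" "adj (lab a) (lab c)" using cover_adj adj_sym D(2) by (auto simp: covers_def)
    moreover have "lt a c" using c(2) \<open>lt a z\<close> lt_trans by (auto simp: le_lt)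
    ultimately show ?thesis using c adjacents_iff[OF mb] by blast
  qed
  have "\<not> covers le a b" using D(2) cover_adj adj_irrefl by metis
  then obtain z where "lt a z" "lt z b" using D(1) by (auto simp: covers_def)
  then show "adjacents a b \<noteq> {}" using 1 by blast
qed

text \<open>Only \<open>d\<close> lies strictly inside, so \<open>a < d < b\<close> is a convex
  chain and full commutativity forbids the label 3; adjacency forbids 2.\<close>

lemma unique_adjacent_label:
  assumes mb: "minimal_balanced le lab a b" and d: "adjacents a b = {d}"
  shows "4 \<le> m (lab a) (lab d)"
proof -
  note D = minimal_balancedD[OF mb]
  have d': "lt a d" "lt d b" "adj (lab a) (lab d)" using d adjacents_iff[OF mb] by blast+
  have mid: "z = d" if "lt a z" "lt z b" for z
    using adjacents_cover(1,2)[OF mb that] le_antisym unfolding d by blast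
  have "z \<in> set [a, d, b]" if "x \<in> set [a, d, b]" "y \<in> set [a, d, b]" "lt x z" "lt z y" for x y z
  proof -
    have "lt a z" using that(1,3) lt_trans[of a d z] lt_trans[of a b z] d'(1) D(1) by auto
    moreover have "lt z b" using that(2,4) lt_trans[of z d b] lt_trans[of z a b] d'(2) D(1) by auto
    ultimately show ?thesis using mid by simp
  qed
  moreover have "set [a, d, b] \<subseteq> E" using d' lt_E by auto
  moreover have "sorted_wrt lt [a, d, b]" using d' D(1) by simp
  ultimately have ch: "convex_chain E le [a, d, b]" unfolding convex_chain_def by blast
  have alt: "\<forall>i<length [a, d, b]. lab ([a, d, b] ! i) = (if even i then lab a else lab d)"
    using D(2) by (auto simp: less_Suc_eq)
  have "m (lab a) (lab d) \<noteq> enat 3"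
  proof
    assume "m (lab a) (lab d) = enat 3"
    then have "enat (length [a, d, b]) = m (lab a) (lab d)" by (simp add: numeral_3_eq_3)
    moreover have "3 \<le> length [a, d, b]" by simp
    moreover have "lab a \<in> S" "lab d \<in> S" using d' lt_E lab_S by blast+
    ultimately show False using heap ch alt unfolding fc_heap_def by blast
  qed
  moreover have "m (lab a) (lab d) \<noteq> 2" using d'(3) by (simp add: adj_def concur_def)
  moreover have "2 \<le> m (lab a) (lab d)"
    using coxeter d'(3) by (auto simp: adj_def coxeter_matrix_def)
  ultimately show ?thesis
    by (cases "m (lab a) (lab d)") (auto simp: numeral_eq_enat)
qed

text \<open>Induction on the size of the interval, with \<open>s\<close> the vertex just left; its
  absence keeps the path from turning back. In a minimal interval, two labels among the adjacent
  pieces make a fork, a single piece forces a label at least 4, and two pieces with one label bound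
  a smaller interval, whose arm is prolonged by \<open>s\<close>.\<close>

lemma balanced_arm:
  assumes "lt a b" "lab a = lab b" "adj s (lab a)"
    and "\<And>z. (a, z) \<in> le \<Longrightarrow> (z, b) \<in> le \<Longrightarrow> lab z \<noteq> s"
  shows "\<exists>h n. arm s (lab a) h n"
  using assms
proof (induction "card (interval le a b)" arbitrary: a b s rule: less_induct)
  case less
  have fin: "finite (interval le a b)"
    using le_E by (intro finite_subset[OF _ finE]) (auto simp: interval_def)
  have ab: "a \<in> interval le a b" "b \<in> interval le a b"
    using less.prems(1) lt_E le_refl by (auto simp: interval_def less_in_def)
  have smaller: "card (interval le c d) < card (interval le a b)"
    if "(a, c) \<in> le" "(d, b) \<in> le" "\<not> (c = a \<and> d = b)" for c d
  proof (rule psubset_card_mono[OF fin])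
    have "interval le c d \<subseteq> interval le a b"
      using that le_trans by (auto simp: interval_def)
    moreover have "a \<notin> interval le c d \<or> b \<notin> interval le c d"
      using that le_antisym by (auto simp: interval_def)
    ultimately show "interval le c d \<subset> interval le a b" using ab by blast
  qed
  show ?case
  proof (cases "\<exists>c. lt a c \<and> lt c b \<and> lab c = lab a")
    case True
    then obtain c where c: "lt a c" "lt c b" "lab c = lab a" by blast
    then have "card (interval le a c) < card (interval le a b)"
      using less.prems(1) lt_E le_refl by (intro smaller) (auto simp: less_in_def)
    moreover have "lab z \<noteq> s" if "(a, z) \<in> le" "(z, c) \<in> le" for z
      using less.prems(4)[of z] that c(2) le_trans by (auto simp: less_in_def)
    ultimately show ?thesis using less.hyps[of a c s] c less.prems(3) by simp
  next
    case False
    then have mb: "minimal_balanced le lab a b"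
      using less.prems by (intro minimal_balancedI) auto
    note A = adjacents_iff[OF mb]
    have not_s: "lab c \<noteq> s" if "c \<in> adjacents a b" for c
      using less.prems(4)[of c] that A by (auto simp: less_in_def)
    consider (fork) c d where "c \<in> adjacents a b" "d \<in> adjacents a b" "lab c \<noteq> lab d"
      | (twice) c d where "c \<in> adjacents a b" "d \<in> adjacents a b" "lab c = lab d" "c \<noteq> d"
      | (single) d where "adjacents a b = {d}"
      using adjacents_cover(3)[OF mb] by blast
    then show ?thesis
    proof cases
      case fork
      then show ?thesis using A not_s less.prems(3) by (intro arm_end[of s "lab a" "lab c" "lab d"]) auto
    next
      case twice
      then obtain c d where cd: "c \<in> adjacents a b" "d \<in> adjacents a b" "lab c = lab d" "lt c d"
        using comparable[of c d] A lt_E by metis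
      then have c: "lt a c" "lt d b" "adj (lab a) (lab c)" using A by auto
      have "\<not> (c = a \<and> d = b)" using c lt_irrefl by blast
      then have "card (interval le c d) < card (interval le a b)"
        using smaller c by (simp add: less_in_def)
      \<comment> \<open>In the smaller interval \<open>lab a\<close> takes over the role of
        \<open>s\<close>; minimality of \<open>[a, b]\<close> keeps it out.\<close>
      moreover have "lab z \<noteq> lab a" if "(c, z) \<in> le" "(z, d) \<in> le" for z
      proof (rule minimal_balancedD(3)[OF mb])
        show "lt a z" "lt z b" using that c lt_trans by (auto simp: le_lt)
      qed
      ultimately obtain h n where "arm (lab a) (lab c) h n"
        using less.hyps[of c d "lab a"] cd c by blast
      then show ?thesis using arm_step less.prems(3) not_s cd(1) by blast
    next
      case single
      then have "d \<in> adjacents a b" by simp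
      then show ?thesis
        using unique_adjacent_label[OF mb single] A not_s less.prems(3)
        by (intro arm_end[of s "lab a" "lab d" "lab d"]) auto
    qed
  qed
qed

section \<open>Necessity of the condition on labels\<close>

lemma rank_lt:
  fixes \<rho> :: "'a \<Rightarrow> int"
  assumes rank: "\<And>x y. covers le x y \<Longrightarrow> \<rho> y = \<rho> x + 1"
  shows "lt x y \<Longrightarrow> \<rho> x < \<rho> y"
proof (induction "card {z. lt x z \<and> lt z y}" arbitrary: y rule: less_induct)
  case less
  obtain z where z: "(x, z) \<in> le" "covers le z y" using lt_cover_below less.prems by blast
  show ?case
  proof (cases "x = z")
    case True
    then show ?thesis using rank z by simp
  next
    case False
    then have xz: "lt x z" using z by (simp add: less_in_def)
    have zy: "lt z y" using z by (simp add: covers_def)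
    have "\<rho> x < \<rho> z" by (rule less.hyps[OF card_between_left[OF xz zy] xz])
    then show ?thesis using rank z by fastforce
  qed
qed

lemma ranked_imp:
  assumes "ranked le" and mb: "minimal_balanced le lab a b"
    and two: "c \<in> adjacents a b" "d \<in> adjacents a b" "lab c \<noteq> lab d"
  shows "inj_on lab (adjacents a b)"
proof (rule ccontr)
  note A = adjacents_iff[OF mb]
  note D = minimal_balancedD[OF mb]
  obtain \<rho> :: "'a \<Rightarrow> int" where rank: "\<And>x y. covers le x y \<Longrightarrow> \<rho> y = \<rho> x + 1"
    using assms(1) unfolding ranked_def by blast
  assume "\<not> inj_on lab (adjacents a b)"
  then obtain p q where "p \<in> adjacents a b" "q \<in> adjacents a b" "lab p = lab q" "p \<noteq> q"
    unfolding inj_on_def by blast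
  then obtain p q where pq: "lt a p" "lt p q" "lt q b"
    using comparable[of p q] A lt_E by metis
  then have "\<rho> a < \<rho> p" "\<rho> p < \<rho> q" "\<rho> q < \<rho> b" by (auto intro: rank_lt[of \<rho>, OF rank])
  \<comment> \<open>The repeated label forces a gap of at least 3, while a label occurring once
    would give exactly 2. So every label among the adjacent pieces is repeated.\<close>
  then have big: "\<rho> a + 2 < \<rho> b" by simp
  have arm: "\<exists>h n. arm (lab a) (lab x) h n" if x: "x \<in> adjacents a b" for x
  proof -
    have "\<exists>y\<in>adjacents a b. lab y = lab x \<and> y \<noteq> x"
    proof (rule ccontr)
      assume "\<not> ?thesis"
      then have "covers le a x" "covers le x b" using unique_adjacent_covers[OF mb x] by blast+
      then show False using rank big by fastforce
    qed
    then obtain y z where yz: "y \<in> adjacents a b" "z \<in> adjacents a b" "lab y = lab x" "lab z = lab x" "lt y z"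
      using x comparable[of x] A lt_E by metis
    have "lab w \<noteq> lab a" if "(y, w) \<in> le" "(w, z) \<in> le" for w
    proof (rule D(3))
      show "lt a w" "lt w b" using that yz A lt_trans by (auto simp: le_lt)
    qed
    then show ?thesis using balanced_arm[of y z "lab a"] yz A by auto
  qed
  show False using infinite_two_arms arm[OF two(1)] arm[OF two(2)] two(3) not_infinite by metis
qed

section \<open>Construction of a rank function\<close>

lemma lower_covers_eq:
  assumes "covers le y x" "covers le z x" "lab y = lab z"
  shows "y = z"
  using comparable[of y z] assms lt_E unfolding covers_def by blast

text \<open>Induction over down-sets: a maximal \<open>x\<close> is removed, the rank on the rest is
  adjusted until all elements covered by \<open>x\<close> share one value \<open>c\<close>, and
  \<open>x\<close> receives \<open>c + 1\<close>.\<close>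

lemma rank_downset:
  assumes cond: "\<And>a b. minimal_balanced le lab a b \<Longrightarrow>
      (\<forall>c\<in>adjacents a b. \<forall>d\<in>adjacents a b. lab c = lab d) \<or> inj_on lab (adjacents a b)"
    and "finite D" "D \<subseteq> E" "\<And>x y. y \<in> D \<Longrightarrow> lt x y \<Longrightarrow> x \<in> D"
  shows "\<exists>\<rho> :: 'a \<Rightarrow> int. \<forall>x\<in>D. \<forall>y\<in>D. covers le x y \<longrightarrow> \<rho> y = \<rho> x + 1"
  using assms(2-)
proof (induction D rule: finite_psubset_induct)
  case (psubset D)
  have tr: "transp_on X lt" and as: "asymp_on X lt" for X
    unfolding transp_on_def asymp_on_def using lt_trans lt_irrefl by blast+
  show ?case
  proof (cases "D = {}")
    case False
    then obtain x where x: "x \<in> D" and "\<forall>y\<in>D. y \<noteq> x \<longrightarrow> \<not> lt x y"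
      using Finite_Set.bex_max_element[OF psubset.hyps as tr] by blast
    then have max: "\<not> lt x y" if "y \<in> D" for y using that lt_irrefl by metis
    let ?D = "D - {x}"
    have below: "y \<in> ?D" if "lt y x" for y using that x psubset.prems(2) lt_irrefl by blast
    have "\<exists>\<rho> :: 'a \<Rightarrow> int. \<forall>x\<in>?D. \<forall>y\<in>?D. covers le x y \<longrightarrow> \<rho> y = \<rho> x + 1"
    proof (rule psubset.IH)
      show "?D \<subset> D" using x by blast
      show "?D \<subseteq> E" using psubset.prems(1) by blast
      show "z \<in> ?D" if "y \<in> ?D" "lt z y" for z y
        using that psubset.prems(2) max by blast
    qed
    then obtain \<rho> :: "'a \<Rightarrow> int" where \<rho>: "\<And>y z. y \<in> ?D \<Longrightarrow> z \<in> ?D \<Longrightarrow> covers le y z \<Longrightarrow> \<rho> z = \<rho> y + 1"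
      by blast
    have "\<exists>\<sigma> c. (\<forall>y\<in>?D. \<forall>z\<in>?D. covers le y z \<longrightarrow> \<sigma> z = \<sigma> y + (1 :: int)) \<and>
        (\<forall>y. covers le y x \<longrightarrow> \<sigma> y = c)"
    proof (cases "\<exists>a. lt a x \<and> lab a = lab x")
      case True
      let ?A = "{a. lt a x \<and> lab a = lab x}"
      have "finite ?A" using lt_E by (intro finite_subset[OF _ finE]) blast
      then obtain a where a: "a \<in> ?A" and "\<forall>c\<in>?A. c \<noteq> a \<longrightarrow> \<not> lt a c"
        using Finite_Set.bex_max_element[OF _ as tr, of ?A] True by blast
      then have mb: "minimal_balanced le lab a x"
        using lt_irrefl by (intro minimal_balancedI) auto
      have ya: "y \<in> adjacents a x" if y: "covers le y x" for y
      proof -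
        have yx: "lt y x" "adj (lab a) (lab y)"
          using y a cover_adj[OF y] adj_sym by (auto simp: covers_def)
        moreover have "lt a y"
          using comparable[of a y] y yx a lt_E adj_irrefl by (auto simp: covers_def)
        ultimately show ?thesis using adjacents_iff[OF mb] by blast
      qed
      \<comment> \<open>Under (b) every element covered by \<open>x\<close> covers \<open>a\<close>;
        under (a) \<open>x\<close> covers at most one element.\<close>
      have "\<exists>c. \<forall>y. covers le y x \<longrightarrow> \<rho> y = c"
      proof (cases "inj_on lab (adjacents a x)")
        case True
        have "\<rho> y = \<rho> a + 1" if y: "covers le y x" for y
        proof (rule \<rho>)
          show "covers le a y"
            by (rule unique_adjacent_covers(1)[OF mb ya[OF y]]) (use True ya[OF y] in \<open>auto dest: inj_onD\<close>)
        qed (use a y below in \<open>auto simp: covers_def\<close>)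
        then show ?thesis by blast
      next
        case False
        then have "y = z" if "covers le y x" "covers le z x" for y z
          using cond[OF mb] ya lower_covers_eq that by blast
        then show ?thesis by metis
      qed
      then show ?thesis using \<rho> by blast
    next
      case False
      define s where "s = lab x"
      have no_s: "lab y \<noteq> s" if "y \<in> ?D" for y
        using comparable[of x y] that x psubset.prems(1) max False unfolding s_def
        by (metis DiffD1 DiffD2 insertI1 subsetD)
      \<comment> \<open>\<open>R\<close> is the graph without the vertex \<open>s\<close>, and its
        components contain the branches at \<open>s\<close>. \<open>H l\<close> collects the
        elements covered by \<open>x\<close> whose label lies in the component of \<open>l\<close>;
        two of them would close a cycle through \<open>s\<close>.\<close>
      define R where "R = {(u, v). adj u v \<and> u \<noteq> s \<and> v \<noteq> s}"
      have symR: "sym (R\<^sup>*)" by (intro sym_rtrancl) (auto simp: sym_def R_def adj_sym)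
      define H where "H l = {y. covers le y x \<and> (lab y, l) \<in> R\<^sup>*}" for l
      have uniq: "y = z" if "y \<in> H l" "z \<in> H l" for y z l
      proof (rule ccontr)
        assume "y \<noteq> z"
        then have ne: "lab y \<noteq> lab z" using lower_covers_eq that by (auto simp: H_def)
        have sy: "adj s (lab y)" and sz: "adj s (lab z)"
          using that cover_adj adj_sym by (auto simp: H_def s_def)
        have "(lab z, lab y) \<in> R\<^sup>*"
          using that symR by (auto simp: H_def dest: symD intro: rtrancl_trans)
        moreover have "R \<subseteq> edges_but s (lab y)" by (auto simp: R_def edges_but_def)
        ultimately have "(lab z, lab y) \<in> (edges_but s (lab y))\<^sup>*" using rtrancl_mono by blast
        moreover have "(s, lab z) \<in> edges_but s (lab y)"
          using sz ne adj_irrefl by (auto simp: edges_but_def)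
        ultimately show False using bridge[OF sy] by (meson converse_rtrancl_into_rtrancl)
      qed
      \<comment> \<open>On each component the rank is shifted so that the element covered by
        \<open>x\<close> gets 0. Where there is none, the \<open>SOME\<close> value is arbitrary but
        depends only on the component, so differences along covers survive.\<close>
      define \<sigma> where "\<sigma> y = \<rho> y - \<rho> (SOME z. z \<in> H (lab y))" for y
      have "\<sigma> z = \<sigma> y + 1" if "y \<in> ?D" "z \<in> ?D" "covers le y z" for y z
      proof -
        have "(lab y, lab z) \<in> R" "(lab z, lab y) \<in> R"
          using no_s that cover_adj adj_sym by (auto simp: R_def)
        then have "H (lab y) = H (lab z)"
          unfolding H_def by (meson rtrancl.rtrancl_into_rtrancl)
        then show ?thesis using \<rho> that by (simp add: \<sigma>_def)
      qed
      moreover have "\<sigma> y = 0" if "covers le y x" for y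
      proof -
        have "y \<in> H (lab y)" using that by (simp add: H_def)
        then have "(SOME z. z \<in> H (lab y)) = y" using uniq by (metis someI)
        then show ?thesis by (simp add: \<sigma>_def)
      qed
      ultimately show ?thesis by blast
    qed
    then obtain \<sigma> :: "'a \<Rightarrow> int" and c where
      \<sigma>: "\<forall>y\<in>?D. \<forall>z\<in>?D. covers le y z \<longrightarrow> \<sigma> z = \<sigma> y + 1" and c: "\<forall>y. covers le y x \<longrightarrow> \<sigma> y = c"
      by blast
    \<comment> \<open>No cover inside \<open>D\<close> starts at \<open>x\<close>, so the new value
      affects only covers ending there.\<close>
    have "(\<sigma>(x := c + 1)) z = (\<sigma>(x := c + 1)) y + 1" if "y \<in> D" "z \<in> D" "covers le y z" for y z
      using that \<sigma> c max lt_irrefl by (auto simp: covers_def)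
    then show ?thesis by blast
  qed simp
qed

end

theorem theorem3p2p3:
  fixes S :: "'s set" and m :: "'s \<Rightarrow> 's \<Rightarrow> enat"
    and E :: "'a set" and le :: "'a rel" and lab :: "'a \<Rightarrow> 's"
  assumes "coxeter_matrix S m"
    and "fc_finite S m"
    and "fc_heap S m E le lab"
  shows "ranked le \<longleftrightarrow>
    (\<forall>a b. minimal_balanced le lab a b \<longrightarrow>
       (\<forall>c\<in>adjacent_pieces m le lab a b. \<forall>d\<in>adjacent_pieces m le lab a b. lab c = lab d) \<or>
       inj_on lab (adjacent_pieces m le lab a b))"
proof -
  interpret finite_fc_heap S m E le lab
    using assms fc_finite_not_infinitely_many by unfold_locales
  show ?thesis
  proof
    assume "ranked le"
    then show "\<forall>a b. minimal_balanced le lab a b \<longrightarrow>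
       (\<forall>c\<in>adjacents a b. \<forall>d\<in>adjacents a b. lab c = lab d) \<or> inj_on lab (adjacents a b)"
      using ranked_imp by blast
  next
    assume "\<forall>a b. minimal_balanced le lab a b \<longrightarrow>
       (\<forall>c\<in>adjacents a b. \<forall>d\<in>adjacents a b. lab c = lab d) \<or> inj_on lab (adjacents a b)"
    then have "\<exists>\<rho> :: 'a \<Rightarrow> int. \<forall>x\<in>E. \<forall>y\<in>E. covers le x y \<longrightarrow> \<rho> y = \<rho> x + 1"
      using finE lt_E by (intro rank_downset) blast+
    then show "ranked le"
      unfolding ranked_def using lt_E by (metis covers_def)
  qed
qed

end
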